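(* Let $A\subseteq B$ be an extension of commutative rings and let $J$ be an ideal of $B$ that is contained in $A$. If $A/J$ is perinormal in $B/J$, then $A$ is perinormal in $B$.
   Context: All rings are commutative with identity; "local" means having a unique maximal ideal (no Noetherian assumption). A ring extension $A\subseteq T$ satisfies going-down (or "$T$ satisfies going-down over $A$") if whenever $\mathfrak p_1\subseteq\mathfrak p_2$ are primes of $A$ and $Q_2\in\operatorname{Spec}T$ satisfies $Q_2\cap A=\mathfrak p_2$, there is $Q_1\in\operatorname{Spec}T$ with $Q_1\subseteq Q_2$ and $Q_1\cap A=\mathfrak p_1$. For an extension $A\subseteq B$ and $\mathfrak p\in\operatorname{Spec}A$, write $B_{\mathfrak p}=B_{A\setminus\mathfrak p}$ for the localization of $B$ at the multiplicative set $A\setminus\mathfrak p$. A local ring $(T,\mathfrak n)$ with $A_{\mathfrak p}\subseteq T$ is centered on $\mathfrak pA_{\mathfrak p}$ if $\mathfrak n\cap A_{\mathfrak p}=\mathfrak pA_{\mathfrak p}$. Definition: for a ring extension $A\subseteq B$, $A$ is perinormal in $B$ if for every prime ideal $\mathfrak p$ of $A$, $A_{\mathfrak p}$ is the only local ring between $A_{\mathfrak p}$ and $B_{\mathfrak p}$ that is centered on $\mathfrak pA_{\mathfrak p}$ and satisfies going-down over $A_{\mathfrak p}$. *)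

theory Defs
  imports "HOL-Algebra.Subrings"
begin

section \<open>Localization at a multiplicative set\<close>

text \<open>
  The fraction \<open>a/s\<close> is the class of all pairs \<open>(b, t)\<close> in \<open>R \<times> S\<close> with
  \<open>u(ta - sb) = 0\<close> for some \<open>u\<close> in \<open>S\<close>. The factor \<open>u\<close> is needed because \<open>S\<close> may contain
  zero divisors.
\<close>

definition fraction :: "('a, 'm) ring_scheme \<Rightarrow> 'a set \<Rightarrow> 'a \<Rightarrow> 'a \<Rightarrow> ('a \<times> 'a) set" where
  "fraction R S a s =
     {(b, t). b \<in> carrier R \<and> t \<in> S \<and>
        (\<exists>u\<in>S. u \<otimes>\<^bsub>R\<^esub> (t \<otimes>\<^bsub>R\<^esub> a \<ominus>\<^bsub>R\<^esub> s \<otimes>\<^bsub>R\<^esub> b) = \<zero>\<^bsub>R\<^esub>)}"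

definition fractions :: "('a, 'm) ring_scheme \<Rightarrow> 'a set \<Rightarrow> 'a set \<Rightarrow> ('a \<times> 'a) set set" where
  "fractions R S X = {fraction R S x s | x s. x \<in> X \<and> s \<in> S}"

text \<open>
  As for \<^const>\<open>FactRing\<close>, an operation on classes is the union of its values over all
  representatives; \<open>mult_fraction\<close> and \<open>add_fraction\<close> below show that it is well defined.
\<close>

definition localization :: "('a, 'm) ring_scheme \<Rightarrow> 'a set \<Rightarrow> ('a \<times> 'a) set ring" where
  "localization R S =
     \<lparr>carrier = fractions R S (carrier R),
      mult = (\<lambda>X Y. \<Union>(a, s)\<in>X. \<Union>(b, t)\<in>Y. fraction R S (a \<otimes>\<^bsub>R\<^esub> b) (s \<otimes>\<^bsub>R\<^esub> t)),
      one = fraction R S \<one>\<^bsub>R\<^esub> \<one>\<^bsub>R\<^esub>,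
      zero = fraction R S \<zero>\<^bsub>R\<^esub> \<one>\<^bsub>R\<^esub>,
      add = (\<lambda>X Y. \<Union>(a, s)\<in>X. \<Union>(b, t)\<in>Y.
               fraction R S (t \<otimes>\<^bsub>R\<^esub> a \<oplus>\<^bsub>R\<^esub> s \<otimes>\<^bsub>R\<^esub> b) (s \<otimes>\<^bsub>R\<^esub> t))\<rparr>"

locale localizing = cring R + submonoid S R for R (structure) and S
begin

lemma S_carr: "s \<in> S \<Longrightarrow> s \<in> carrier R"
  using subset by blast

lemma fraction_mem_iff:
  assumes "a \<in> carrier R" "s \<in> S"
  shows "(b, t) \<in> fraction R S a s \<longleftrightarrow>
    b \<in> carrier R \<and> t \<in> S \<and> (\<exists>u\<in>S. u \<otimes> (t \<otimes> a) = u \<otimes> (s \<otimes> b))"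
proof -
  have "u \<otimes> (t \<otimes> a \<ominus> s \<otimes> b) = \<zero> \<longleftrightarrow> u \<otimes> (t \<otimes> a) = u \<otimes> (s \<otimes> b)"
    if "u \<in> S" "t \<in> S" "b \<in> carrier R" for u
  proof -
    have c: "u \<in> carrier R" "t \<in> carrier R" "s \<in> carrier R" using that assms S_carr by auto
    have "u \<otimes> (t \<otimes> a \<ominus> s \<otimes> b) = u \<otimes> (t \<otimes> a) \<ominus> u \<otimes> (s \<otimes> b)"
      using c that assms by algebra
    then show ?thesis using c that assms by simp
  qed
  then show ?thesis unfolding fraction_def by blast
qed

lemma fraction_self: "a \<in> carrier R \<Longrightarrow> s \<in> S \<Longrightarrow> (a, s) \<in> fraction R S a s"
  by (auto simp: fraction_mem_iff)

lemma fraction_subset: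
  assumes "a \<in> carrier R" "s \<in> S" "b \<in> carrier R" "t \<in> S"
    and "u \<in> S" "u \<otimes> (t \<otimes> a) = u \<otimes> (s \<otimes> b)"
  shows "fraction R S b t \<subseteq> fraction R S a s"
proof clarify
  fix c v assume "(c, v) \<in> fraction R S b t"
  then obtain w where w: "c \<in> carrier R" "v \<in> S" "w \<in> S" "w \<otimes> (v \<otimes> b) = w \<otimes> (t \<otimes> c)"
    using assms by (auto simp: fraction_mem_iff)
  note carr = assms(1,3) w(1) S_carr[OF assms(2)] S_carr[OF assms(4)] S_carr[OF assms(5)]
    S_carr[OF w(2)] S_carr[OF w(3)]
  have "(u \<otimes> w \<otimes> t) \<otimes> (v \<otimes> a) = w \<otimes> v \<otimes> (u \<otimes> (t \<otimes> a))" using carr by algebra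
  also have "\<dots> = u \<otimes> s \<otimes> (w \<otimes> (v \<otimes> b))" unfolding assms(6) using carr by algebra
  also have "\<dots> = (u \<otimes> w \<otimes> t) \<otimes> (s \<otimes> c)" unfolding w(4) using carr by algebra
  finally show "(c, v) \<in> fraction R S a s"
    using assms w by (auto simp: fraction_mem_iff intro!: bexI[of _ "u \<otimes> w \<otimes> t"])
qed

lemma fraction_eq_iff:
  assumes "a \<in> carrier R" "s \<in> S" "b \<in> carrier R" "t \<in> S"
  shows "fraction R S a s = fraction R S b t \<longleftrightarrow> (\<exists>u\<in>S. u \<otimes> (t \<otimes> a) = u \<otimes> (s \<otimes> b))"
proof
  assume "fraction R S a s = fraction R S b t"
  then have "(b, t) \<in> fraction R S a s" using fraction_self assms by auto
  then show "\<exists>u\<in>S. u \<otimes> (t \<otimes> a) = u \<otimes> (s \<otimes> b)" using assms by (simp add: fraction_mem_iff)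
next
  assume "\<exists>u\<in>S. u \<otimes> (t \<otimes> a) = u \<otimes> (s \<otimes> b)"
  then obtain u where "u \<in> S" "u \<otimes> (t \<otimes> a) = u \<otimes> (s \<otimes> b)" by blast
  then show "fraction R S a s = fraction R S b t"
    using fraction_subset[of a s b t u] fraction_subset[of b t a s u] assms by auto
qed

lemma fraction_eqI:
  assumes "a \<in> carrier R" "s \<in> S" "b \<in> carrier R" "t \<in> S" "t \<otimes> a = s \<otimes> b"
  shows "fraction R S a s = fraction R S b t"
  using assms by (auto simp: fraction_eq_iff intro!: bexI[of _ "\<one>"])

lemma UN_fraction:
  assumes "a \<in> carrier R" "s \<in> S" "b \<in> carrier R" "t \<in> S"
    and "\<And>a' s' b' t'. \<lbrakk>(a', s') \<in> fraction R S a s; (b', t') \<in> fraction R S b t\<rbrakk>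
           \<Longrightarrow> f a' s' b' t' = f a s b t"
  shows "(\<Union>(a', s')\<in>fraction R S a s. \<Union>(b', t')\<in>fraction R S b t. f a' s' b' t') = f a s b t"
  using assms fraction_self[OF assms(1,2)] fraction_self[OF assms(3,4)] by fast

lemma mult_fraction:
  assumes "a \<in> carrier R" "s \<in> S" "b \<in> carrier R" "t \<in> S"
  shows "fraction R S a s \<otimes>\<^bsub>localization R S\<^esub> fraction R S b t = fraction R S (a \<otimes> b) (s \<otimes> t)"
  unfolding localization_def monoid.simps
proof (rule UN_fraction[OF assms])
  fix a' s' b' t' assume h: "(a', s') \<in> fraction R S a s" "(b', t') \<in> fraction R S b t"
  then obtain u w where uw: "a' \<in> carrier R" "s' \<in> S" "b' \<in> carrier R" "t' \<in> S" "u \<in> S" "w \<in> S"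
    "u \<otimes> (s' \<otimes> a) = u \<otimes> (s \<otimes> a')" "w \<otimes> (t' \<otimes> b) = w \<otimes> (t \<otimes> b')"
    using assms by (auto simp: fraction_mem_iff)
  note carr = assms(1,3) uw(1,3) S_carr[OF assms(2)] S_carr[OF assms(4)] S_carr[OF uw(2)]
    S_carr[OF uw(4)] S_carr[OF uw(5)] S_carr[OF uw(6)]
  have "(u \<otimes> w) \<otimes> ((s \<otimes> t) \<otimes> (a' \<otimes> b')) = (u \<otimes> (s \<otimes> a')) \<otimes> (w \<otimes> (t \<otimes> b'))"
    using carr by algebra
  also have "\<dots> = (u \<otimes> w) \<otimes> ((s' \<otimes> t') \<otimes> (a \<otimes> b))"
    unfolding uw(7)[symmetric] uw(8)[symmetric] using carr by algebra
  finally show "fraction R S (a' \<otimes> b') (s' \<otimes> t') = fraction R S (a \<otimes> b) (s \<otimes> t)"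
    using assms uw by (auto simp: fraction_eq_iff intro!: bexI[of _ "u \<otimes> w"])
qed

lemma add_fraction:
  assumes "a \<in> carrier R" "s \<in> S" "b \<in> carrier R" "t \<in> S"
  shows "fraction R S a s \<oplus>\<^bsub>localization R S\<^esub> fraction R S b t =
    fraction R S (t \<otimes> a \<oplus> s \<otimes> b) (s \<otimes> t)"
  unfolding localization_def ring.simps
proof (rule UN_fraction[OF assms])
  fix a' s' b' t' assume h: "(a', s') \<in> fraction R S a s" "(b', t') \<in> fraction R S b t"
  then obtain u w where uw: "a' \<in> carrier R" "s' \<in> S" "b' \<in> carrier R" "t' \<in> S" "u \<in> S" "w \<in> S"
    "u \<otimes> (s' \<otimes> a) = u \<otimes> (s \<otimes> a')" "w \<otimes> (t' \<otimes> b) = w \<otimes> (t \<otimes> b')"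
    using assms by (auto simp: fraction_mem_iff)
  note carr = assms(1,3) uw(1,3) S_carr[OF assms(2)] S_carr[OF assms(4)] S_carr[OF uw(2)]
    S_carr[OF uw(4)] S_carr[OF uw(5)] S_carr[OF uw(6)]
  have "(u \<otimes> w) \<otimes> ((s \<otimes> t) \<otimes> (t' \<otimes> a' \<oplus> s' \<otimes> b')) =
      w \<otimes> t \<otimes> t' \<otimes> (u \<otimes> (s \<otimes> a')) \<oplus> u \<otimes> s \<otimes> s' \<otimes> (w \<otimes> (t \<otimes> b'))"
    using carr by algebra
  also have "\<dots> = (u \<otimes> w) \<otimes> ((s' \<otimes> t') \<otimes> (t \<otimes> a \<oplus> s \<otimes> b))"
    unfolding uw(7)[symmetric] uw(8)[symmetric] using carr by algebra
  finally show "fraction R S (t' \<otimes> a' \<oplus> s' \<otimes> b') (s' \<otimes> t') =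
      fraction R S (t \<otimes> a \<oplus> s \<otimes> b) (s \<otimes> t)"
    using assms uw carr by (subst fraction_eq_iff) (auto intro!: bexI[of _ "u \<otimes> w"])
qed

lemma localization_carrierE:
  assumes "X \<in> carrier (localization R S)"
  obtains a s where "a \<in> carrier R" "s \<in> S" "X = fraction R S a s"
  using assms by (auto simp: localization_def fractions_def)

lemma fraction_closed [simp]:
  "a \<in> carrier R \<Longrightarrow> s \<in> S \<Longrightarrow> fraction R S a s \<in> carrier (localization R S)"
  by (auto simp: localization_def fractions_def)

lemma localization_zero: "\<zero>\<^bsub>localization R S\<^esub> = fraction R S \<zero> \<one>"
  and localization_one: "\<one>\<^bsub>localization R S\<^esub> = fraction R S \<one> \<one>"
  by (simp_all add: localization_def)

lemma localization_cring: "cring (localization R S)"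
proof (rule cringI)
  show "abelian_group (localization R S)"
  proof (rule abelian_groupI)
    fix X assume "X \<in> carrier (localization R S)"
    then obtain a s where X: "a \<in> carrier R" "s \<in> S" "X = fraction R S a s"
      by (rule localization_carrierE)
    note c = X(1) S_carr[OF X(2)]
    show "\<zero>\<^bsub>localization R S\<^esub> \<oplus>\<^bsub>localization R S\<^esub> X = X"
      using X c by (simp add: localization_zero add_fraction)
    have "fraction R S (\<ominus> a) s \<oplus>\<^bsub>localization R S\<^esub> X = \<zero>\<^bsub>localization R S\<^esub>"
      unfolding X localization_zero using X(1,2) c
      by (subst add_fraction, simp_all, intro fraction_eqI) (simp_all add: r_minus l_neg)
    then show "\<exists>Y\<in>carrier (localization R S). Y \<oplus>\<^bsub>localization R S\<^esub> X = \<zero>\<^bsub>localization R S\<^esub>"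
      using X by (intro bexI[of _ "fraction R S (\<ominus> a) s"]) auto
    fix Y assume "Y \<in> carrier (localization R S)"
    then obtain b t where Y: "b \<in> carrier R" "t \<in> S" "Y = fraction R S b t"
      by (rule localization_carrierE)
    note c = c Y(1) S_carr[OF Y(2)]
    show "X \<oplus>\<^bsub>localization R S\<^esub> Y \<in> carrier (localization R S)"
      using X Y c by (simp add: add_fraction)
    show "X \<oplus>\<^bsub>localization R S\<^esub> Y = Y \<oplus>\<^bsub>localization R S\<^esub> X"
      using X Y c by (simp add: add_fraction m_comm a_comm)
    fix Z assume "Z \<in> carrier (localization R S)"
    then obtain d v where Z: "d \<in> carrier R" "v \<in> S" "Z = fraction R S d v"
      by (rule localization_carrierE)
    note c = c Z(1) S_carr[OF Z(2)]
    have "v \<otimes> (t \<otimes> a \<oplus> s \<otimes> b) \<oplus> s \<otimes> t \<otimes> d = t \<otimes> v \<otimes> a \<oplus> s \<otimes> (v \<otimes> b \<oplus> t \<otimes> d)"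
      using c by algebra
    then show "X \<oplus>\<^bsub>localization R S\<^esub> Y \<oplus>\<^bsub>localization R S\<^esub> Z =
        X \<oplus>\<^bsub>localization R S\<^esub> (Y \<oplus>\<^bsub>localization R S\<^esub> Z)"
      using X Y Z c by (simp add: add_fraction m_assoc)
  qed (simp add: localization_zero)
  show "comm_monoid (localization R S)"
  proof (rule comm_monoidI)
    fix X assume "X \<in> carrier (localization R S)"
    then obtain a s where X: "a \<in> carrier R" "s \<in> S" "X = fraction R S a s"
      by (rule localization_carrierE)
    note c = X(1) S_carr[OF X(2)]
    show "\<one>\<^bsub>localization R S\<^esub> \<otimes>\<^bsub>localization R S\<^esub> X = X"
      using X c by (simp add: localization_one mult_fraction)
    fix Y assume "Y \<in> carrier (localization R S)"
    then obtain b t where Y: "b \<in> carrier R" "t \<in> S" "Y = fraction R S b t"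
      by (rule localization_carrierE)
    note c = c Y(1) S_carr[OF Y(2)]
    show "X \<otimes>\<^bsub>localization R S\<^esub> Y \<in> carrier (localization R S)"
      using X Y c by (simp add: mult_fraction)
    show "X \<otimes>\<^bsub>localization R S\<^esub> Y = Y \<otimes>\<^bsub>localization R S\<^esub> X"
      using X Y c by (simp add: mult_fraction m_comm)
    fix Z assume "Z \<in> carrier (localization R S)"
    then obtain d v where Z: "d \<in> carrier R" "v \<in> S" "Z = fraction R S d v"
      by (rule localization_carrierE)
    show "X \<otimes>\<^bsub>localization R S\<^esub> Y \<otimes>\<^bsub>localization R S\<^esub> Z =
        X \<otimes>\<^bsub>localization R S\<^esub> (Y \<otimes>\<^bsub>localization R S\<^esub> Z)"
      using X Y Z c S_carr[OF Z(2)] by (simp add: mult_fraction m_assoc)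
  qed (simp add: localization_one)
next
  fix X Y Z
  assume "X \<in> carrier (localization R S)" "Y \<in> carrier (localization R S)"
    "Z \<in> carrier (localization R S)"
  then obtain a s b t d v where XYZ: "a \<in> carrier R" "s \<in> S" "X = fraction R S a s"
    "b \<in> carrier R" "t \<in> S" "Y = fraction R S b t"
    "d \<in> carrier R" "v \<in> S" "Z = fraction R S d v"
    by (elim localization_carrierE) blast
  have c: "s \<in> carrier R" "t \<in> carrier R" "v \<in> carrier R" using XYZ S_carr by auto
  have "fraction R S ((t \<otimes> a \<oplus> s \<otimes> b) \<otimes> d) (s \<otimes> t \<otimes> v) =
      fraction R S (t \<otimes> v \<otimes> (a \<otimes> d) \<oplus> s \<otimes> v \<otimes> (b \<otimes> d)) (s \<otimes> v \<otimes> (t \<otimes> v))"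
  proof (rule fraction_eqI)
    note c = c XYZ(1,4,7)
    show "s \<otimes> v \<otimes> (t \<otimes> v) \<otimes> ((t \<otimes> a \<oplus> s \<otimes> b) \<otimes> d) =
        s \<otimes> t \<otimes> v \<otimes> (t \<otimes> v \<otimes> (a \<otimes> d) \<oplus> s \<otimes> v \<otimes> (b \<otimes> d))"
      using c by algebra
  qed (use XYZ c in simp_all)
  then show "(X \<oplus>\<^bsub>localization R S\<^esub> Y) \<otimes>\<^bsub>localization R S\<^esub> Z =
      X \<otimes>\<^bsub>localization R S\<^esub> Z \<oplus>\<^bsub>localization R S\<^esub> Y \<otimes>\<^bsub>localization R S\<^esub> Z"
    using XYZ c by (simp add: add_fraction mult_fraction)
qed

lemma minus_fraction:
  assumes "a \<in> carrier R" "s \<in> S"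
  shows "\<ominus>\<^bsub>localization R S\<^esub> fraction R S a s = fraction R S (\<ominus> a) s"
proof -
  interpret L: cring "localization R S" by (rule localization_cring)
  have "fraction R S (\<ominus> a) s \<oplus>\<^bsub>localization R S\<^esub> fraction R S a s = \<zero>\<^bsub>localization R S\<^esub>"
    unfolding localization_zero using assms S_carr[OF assms(2)]
    by (subst add_fraction, simp_all, intro fraction_eqI) (simp_all add: r_minus l_neg)
  then show ?thesis using assms by (intro L.minus_equality) auto
qed

end


section \<open>Perinormality\<close>

definition local_ring :: "('a, 'm) ring_scheme \<Rightarrow> bool" where
  "local_ring R \<longleftrightarrow> cring R \<and> (\<exists>!M. maximalideal M R)"

text \<open>In the next two definitions, \<open>A\<close> is a subring of \<open>T\<close> with the operations of \<open>T\<close>.\<close>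

definition centered_on :: "('a, 'm) ring_scheme \<Rightarrow> ('a, 'n) ring_scheme \<Rightarrow> 'a set \<Rightarrow> bool" where
  "centered_on T A P \<longleftrightarrow> (THE N. maximalideal N T) \<inter> carrier A = P"

definition going_down :: "('a, 'm) ring_scheme \<Rightarrow> ('a, 'n) ring_scheme \<Rightarrow> bool" where
  "going_down A T \<longleftrightarrow>
     (\<forall>p1 p2 Q2. primeideal p1 A \<and> primeideal p2 A \<and> p1 \<subseteq> p2 \<and>
        primeideal Q2 T \<and> Q2 \<inter> carrier A = p2 \<longrightarrow>
        (\<exists>Q1. primeideal Q1 T \<and> Q1 \<subseteq> Q2 \<and> Q1 \<inter> carrier A = p1))"

text \<open>
  For a subring \<open>A\<close> of \<open>B\<close> and a prime \<open>p\<close> of \<open>A\<close>, put \<open>S = A - p\<close>. The ring \<open>A\<^sub>p\<close> is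
  represented by its image in \<open>B\<^sub>p\<close>, namely the fractions with numerator in \<open>A\<close>
  (\<open>localization_subring_iso\<close> below), and \<open>pA\<^sub>p\<close> consists of the fractions with numerator
  in \<open>p\<close> (\<open>genideal_fractions\<close> below). The rings between \<open>A\<^sub>p\<close> and \<open>B\<^sub>p\<close> are the subrings
  of \<open>B\<^sub>p\<close> that contain \<open>A\<^sub>p\<close>.
\<close>

definition perinormal_in :: "'a set \<Rightarrow> ('a, 'm) ring_scheme \<Rightarrow> bool" where
  "perinormal_in A B \<longleftrightarrow>
     (\<forall>p. primeideal p (B\<lparr>carrier := A\<rparr>) \<longrightarrow>
        (let S = A - p;
             Bp = localization B S;
             Ap = fractions B S A;
             pAp = fractions B S p
         in {T. subring T Bp \<and> Ap \<subseteq> T \<and>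
                local_ring (Bp\<lparr>carrier := T\<rparr>) \<and>
                centered_on (Bp\<lparr>carrier := T\<rparr>) (Bp\<lparr>carrier := Ap\<rparr>) pAp \<and>
                going_down (Bp\<lparr>carrier := Ap\<rparr>) (Bp\<lparr>carrier := T\<rparr>)} = {Ap}))"

locale prime_of_subring = cring B + A: subring A B + p: primeideal p "B\<lparr>carrier := A\<rparr>"
  for B (structure) and A and p
begin

lemma A_sub: "A \<subseteq> carrier B" and p_sub: "p \<subseteq> A"
  using subringE(1)[OF A.subring_axioms] p.a_subset by auto

sublocale localizing B "A - p"
proof unfold_locales
  show "\<one> \<in> A - p"
    using p.one_imp_carrier p.I_notcarr subringE(3)[OF A.subring_axioms] by auto
  show "x \<otimes> y \<in> A - p" if "x \<in> A - p" "y \<in> A - p" for x y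
    using p.I_prime[of x y] that subringE(6)[OF A.subring_axioms] by auto
qed (use A_sub in auto)

lemma localizing_A: "localizing (B\<lparr>carrier := A\<rparr>) (A - p)"
proof -
  interpret AA: cring "B\<lparr>carrier := A\<rparr>" by (rule p.is_cring)
  show ?thesis using one_closed m_closed
    by unfold_locales auto
qed

lemma fractionsI: "x \<in> Y \<Longrightarrow> s \<in> A - p \<Longrightarrow> fraction B (A - p) x s \<in> fractions B (A - p) Y"
  by (auto simp: fractions_def)

lemma fractions_subring: "subring (fractions B (A - p) A) (localization B (A - p))"
proof -
  interpret L: cring "localization B (A - p)" by (rule localization_cring)
  note AE = subringE[OF A.subring_axioms]
  show ?thesis
  proof (rule L.subringI)
    show "fractions B (A - p) A \<subseteq> carrier (localization B (A - p))"
      using A_sub by (auto simp: fractions_def localization_def)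
    show "\<one>\<^bsub>localization B (A - p)\<^esub> \<in> fractions B (A - p) A"
      unfolding localization_one using AE(3) one_closed by (intro fractionsI) auto
  next
    fix X assume "X \<in> fractions B (A - p) A"
    then obtain a s where X: "a \<in> A" "s \<in> A - p" "X = fraction B (A - p) a s"
      by (auto simp: fractions_def)
    have a: "a \<in> carrier B" using X A_sub by blast
    show "\<ominus>\<^bsub>localization B (A - p)\<^esub> X \<in> fractions B (A - p) A"
      unfolding X minus_fraction[OF a X(2)] using AE(5)[OF X(1)] X(2) by (rule fractionsI)
    fix Y assume "Y \<in> fractions B (A - p) A"
    then obtain b t where Y: "b \<in> A" "t \<in> A - p" "Y = fraction B (A - p) b t"
      by (auto simp: fractions_def)
    have b: "b \<in> carrier B" using Y A_sub by blast
    have st: "s \<otimes> t \<in> A - p" using X Y by (intro m_closed)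
    show "X \<otimes>\<^bsub>localization B (A - p)\<^esub> Y \<in> fractions B (A - p) A"
      unfolding X Y mult_fraction[OF a X(2) b Y(2)] using AE(6)[OF X(1) Y(1)] st
      by (rule fractionsI)
    show "X \<oplus>\<^bsub>localization B (A - p)\<^esub> Y \<in> fractions B (A - p) A"
      unfolding X Y add_fraction[OF a X(2) b Y(2)] using X Y AE(6,7) st
      by (intro fractionsI) auto
  qed
qed

lemma fractions_ideal:
  "ideal (fractions B (A - p) p) (localization B (A - p)\<lparr>carrier := fractions B (A - p) A\<rparr>)"
    (is "ideal ?I ?Ap")
proof -
  interpret L: cring "localization B (A - p)" by (rule localization_cring)
  interpret Ap: cring ?Ap
    using L.subcring_iff L.subcringI'[OF fractions_subring]
      subringE(1)[OF fractions_subring] by blast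
  have IA: "?I \<subseteq> carrier ?Ap" using p_sub by (auto simp: fractions_def)
  have mult: "X \<otimes>\<^bsub>?Ap\<^esub> Y \<in> ?I" if XY: "X \<in> carrier ?Ap" "Y \<in> ?I" for X Y
  proof -
    obtain a s where X: "a \<in> A" "s \<in> A - p" "X = fraction B (A - p) a s"
      using XY by (auto simp: fractions_def)
    obtain y t where Y: "y \<in> p" "t \<in> A - p" "Y = fraction B (A - p) y t"
      using XY by (auto simp: fractions_def)
    have c: "a \<in> carrier B" "y \<in> carrier B" using X Y A_sub p_sub by auto
    have "a \<otimes> y \<in> p" using p.I_l_closed[OF Y(1), of a] X by simp
    then show ?thesis
      using X Y m_closed[OF X(2) Y(2)] by (simp add: mult_fraction[OF c(1) X(2) c(2) Y(2)] fractionsI)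
  qed
  show ?thesis
  proof (rule idealI)
    show "ring ?Ap" by (rule Ap.ring_axioms)
    show "subgroup ?I (add_monoid ?Ap)"
    proof (rule Ap.add.subgroupI)
      show "?I \<subseteq> carrier ?Ap" by (rule IA)
      have "fraction B (A - p) \<zero> \<one> \<in> ?I"
        using additive_subgroup.zero_closed[OF p.additive_subgroup_axioms] one_closed by (intro fractionsI) auto
      then show "?I \<noteq> {}" by blast
    next
      fix X assume X: "X \<in> ?I"
      have "\<ominus>\<^bsub>?Ap\<^esub> X = (\<ominus>\<^bsub>?Ap\<^esub> \<one>\<^bsub>?Ap\<^esub>) \<otimes>\<^bsub>?Ap\<^esub> X"
        using X IA Ap.l_minus[OF Ap.one_closed, of X] Ap.l_one[of X] by auto
      then show "\<ominus>\<^bsub>?Ap\<^esub> X \<in> ?I"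
        using mult[OF Ap.a_inv_closed[OF Ap.one_closed] X] by simp
    next
      fix X Y assume XY: "X \<in> ?I" "Y \<in> ?I"
      obtain x s where X: "x \<in> p" "s \<in> A - p" "X = fraction B (A - p) x s"
        using XY by (auto simp: fractions_def)
      obtain y t where Y: "y \<in> p" "t \<in> A - p" "Y = fraction B (A - p) y t"
        using XY by (auto simp: fractions_def)
      have c: "x \<in> carrier B" "y \<in> carrier B" using X Y A_sub p_sub by auto
      have "t \<otimes> x \<oplus> s \<otimes> y \<in> p"
        using p.I_l_closed[OF X(1), of t] p.I_l_closed[OF Y(1), of s] X Y
          additive_subgroup.a_closed[OF p.additive_subgroup_axioms, of "t \<otimes> x" "s \<otimes> y"] by simp
      then show "X \<oplus>\<^bsub>?Ap\<^esub> Y \<in> ?I"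
        using X Y m_closed[OF X(2) Y(2)]
        by (simp add: add_fraction[OF c(1) X(2) c(2) Y(2)] fractionsI)
    qed
    show "\<And>Y X. Y \<in> ?I \<Longrightarrow> X \<in> carrier ?Ap \<Longrightarrow> X \<otimes>\<^bsub>?Ap\<^esub> Y \<in> ?I" by (rule mult)
    show "Y \<otimes>\<^bsub>?Ap\<^esub> X \<in> ?I" if "Y \<in> ?I" "X \<in> carrier ?Ap" for X Y
      using mult[OF that(2,1)] Ap.m_comm[of X Y] that IA by auto
  qed
qed

lemma genideal_fractions:
  "genideal (localization B (A - p)\<lparr>carrier := fractions B (A - p) A\<rparr>)
     ((\<lambda>x. fraction B (A - p) x \<one>) ` p) = fractions B (A - p) p"
    (is "genideal ?Ap ?G = ?I")
proof -
  interpret I: ideal ?I ?Ap by (rule fractions_ideal)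
  have G: "?G \<subseteq> ?I" using one_closed by (auto intro: fractionsI)
  interpret J: ideal "genideal ?Ap ?G" ?Ap
    using G I.a_subset by (intro I.genideal_ideal) blast
  show ?thesis
  proof
    show "genideal ?Ap ?G \<subseteq> ?I" by (rule I.genideal_minimal[OF fractions_ideal G])
    show "?I \<subseteq> genideal ?Ap ?G"
    proof
      fix X assume "X \<in> ?I"
      then obtain x s where X: "x \<in> p" "s \<in> A - p" "X = fraction B (A - p) x s"
        by (auto simp: fractions_def)
      have c: "x \<in> carrier B" "s \<in> carrier B" using X A_sub p_sub by auto
      have "fraction B (A - p) x \<one> \<in> genideal ?Ap ?G"
        using X(1) I.genideal_self[of ?G] G I.a_subset by blast
      moreover have "fraction B (A - p) \<one> s \<in> carrier ?Ap"
        using X(2) one_closed by (auto intro: fractionsI)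
      ultimately have "fraction B (A - p) \<one> s \<otimes>\<^bsub>?Ap\<^esub> fraction B (A - p) x \<one>
          \<in> genideal ?Ap ?G"
        by (rule J.I_l_closed)
      then show "X \<in> genideal ?Ap ?G"
        using X c mult_fraction[OF S_carr[OF one_closed] X(2) c(1) one_closed] by simp
    qed
  qed
qed

lemma localization_subring_iso:
  "(\<lambda>X. \<Union>(a, s)\<in>X. fraction B (A - p) a s) \<in>
     ring_iso (localization (B\<lparr>carrier := A\<rparr>) (A - p))
       (localization B (A - p)\<lparr>carrier := fractions B (A - p) A\<rparr>)"
    (is "?h \<in> ring_iso ?LA ?Ap")
proof -
  interpret AL: localizing "B\<lparr>carrier := A\<rparr>" "A - p" by (rule localizing_A)
  let ?f = "fraction (B\<lparr>carrier := A\<rparr>) (A - p)"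
  note AE = subringE[OF A.subring_axioms]
  have AB: "a \<in> carrier B" if "a \<in> A" for a using that A_sub by blast
  have rel: "?f a s = ?f b t \<longleftrightarrow> fraction B (A - p) a s = fraction B (A - p) b t"
    if "a \<in> A" "s \<in> A - p" "b \<in> A" "t \<in> A - p" for a s b t
    using that AL.fraction_eq_iff[of a s b t] fraction_eq_iff[of a s b t] AB by simp
  have h: "?h (?f a s) = fraction B (A - p) a s" if as: "a \<in> A" "s \<in> A - p" for a s
  proof -
    have const: "fraction B (A - p) b t = fraction B (A - p) a s" if bt: "(b, t) \<in> ?f a s" for b t
    proof -
      have "b \<in> A" "t \<in> A - p" "?f a s = ?f b t"
        using bt as AL.fraction_mem_iff[of a s b t] AL.fraction_eq_iff[of a s b t] by auto
      then show ?thesis using rel[of a s b t] as by simp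
    qed
    have "(a, s) \<in> ?f a s" using as AL.fraction_self[of a s] by simp
    moreover have "?h (?f a s) = (\<Union>z\<in>?f a s. fraction B (A - p) a s)"
      by (rule SUP_cong) (auto simp: const)
    ultimately show ?thesis by blast
  qed
  have carr: "carrier ?LA = {?f a s | a s. a \<in> A \<and> s \<in> A - p}"
    by (simp add: localization_def fractions_def)
  have one: "\<one> \<in> A" "\<one> \<in> A - p" using AE(3) one_closed by auto
  have "?h \<in> ring_hom ?LA ?Ap"
  proof (rule ring_hom_memI)
    fix X assume "X \<in> carrier ?LA"
    then obtain a s where X: "a \<in> A" "s \<in> A - p" "X = ?f a s" unfolding carr by blast
    show "?h X \<in> carrier ?Ap"
      using X(1,2) by (simp only: X(3) h) (auto intro: fractionsI)
    fix Y assume "Y \<in> carrier ?LA"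
    then obtain b t where Y: "b \<in> A" "t \<in> A - p" "Y = ?f b t" unfolding carr by blast
    have st: "s \<otimes> t \<in> A - p" using X Y by (intro m_closed)
    have m: "X \<otimes>\<^bsub>?LA\<^esub> Y = ?f (a \<otimes> b) (s \<otimes> t)"
      using AL.mult_fraction[of a s b t] X Y by simp
    have a: "X \<oplus>\<^bsub>?LA\<^esub> Y = ?f (t \<otimes> a \<oplus> s \<otimes> b) (s \<otimes> t)"
      using AL.add_fraction[of a s b t] X Y by simp
    have mem: "a \<otimes> b \<in> A" "t \<otimes> a \<oplus> s \<otimes> b \<in> A" using X Y AE(6,7) by auto
    show "?h (X \<otimes>\<^bsub>?LA\<^esub> Y) = ?h X \<otimes>\<^bsub>?Ap\<^esub> ?h Y"
      unfolding m h[OF mem(1) st] unfolding X(3) Y(3) h[OF X(1,2)] h[OF Y(1,2)]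
      using mult_fraction[OF AB[OF X(1)] X(2) AB[OF Y(1)] Y(2)] by simp
    show "?h (X \<oplus>\<^bsub>?LA\<^esub> Y) = ?h X \<oplus>\<^bsub>?Ap\<^esub> ?h Y"
      unfolding a h[OF mem(2) st] unfolding X(3) Y(3) h[OF X(1,2)] h[OF Y(1,2)]
      using add_fraction[OF AB[OF X(1)] X(2) AB[OF Y(1)] Y(2)] by simp
  next
    show "?h \<one>\<^bsub>?LA\<^esub> = \<one>\<^bsub>?Ap\<^esub>"
      using h[OF one] by (simp add: localization_def)
  qed
  moreover have "bij_betw ?h (carrier ?LA) (carrier ?Ap)"
  proof (rule bij_betw_imageI)
    show "inj_on ?h (carrier ?LA)"
    proof (rule inj_onI)
      fix X Y assume "X \<in> carrier ?LA" "Y \<in> carrier ?LA" and e: "?h X = ?h Y"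
      then obtain a s b t where X: "a \<in> A" "s \<in> A - p" "X = ?f a s"
        and Y: "b \<in> A" "t \<in> A - p" "Y = ?f b t" unfolding carr by blast
      show "X = Y"
        using e rel[OF X(1,2) Y(1,2)] unfolding X(3) Y(3) h[OF X(1,2)] h[OF Y(1,2)] by blast
    qed
    show "?h ` carrier ?LA = carrier ?Ap"
    proof (intro equalityI subsetI)
      fix Y assume "Y \<in> ?h ` carrier ?LA"
      then obtain a s where "a \<in> A" "s \<in> A - p" "Y = ?h (?f a s)" unfolding carr by blast
      then show "Y \<in> carrier ?Ap" using h[of a s] fractionsI[of a A s] by simp
    next
      fix Y assume "Y \<in> carrier ?Ap"
      then obtain a s where Y: "a \<in> A" "s \<in> A - p" "Y = fraction B (A - p) a s"
        by (auto simp: fractions_def)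
      have "?f a s \<in> carrier ?LA" unfolding carr using Y by blast
      moreover have "Y = ?h (?f a s)" unfolding h[OF Y(1,2)] by (rule Y(3))
      ultimately show "Y \<in> ?h ` carrier ?LA" by (rule rev_image_eqI)
    qed
  qed
  ultimately show ?thesis unfolding ring_iso_def by blast
qed

end

end

theory Submission
  imports Defs
begin

text \<open>
  Let \<open>p\<close> be a prime of \<open>A\<close>. If \<open>J\<close> contains some \<open>j \<notin> p\<close>, then \<open>b/s = jb/js\<close> with \<open>jb \<in> J \<subseteq> A\<close>, so
  \<open>A\<^sub>p = B\<^sub>p\<close>. If \<open>J \<subseteq> p\<close>, then \<open>B \<rightarrow> B/J\<close> induces a surjection \<open>B\<^sub>p \<rightarrow> (B/J)\<^bsub>p/J\<^esub>\<close> whose kernel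
  \<open>J\<^sub>p\<close> lies in \<open>pA\<^sub>p\<close>. By the correspondence of ideals, the image of a local ring \<open>T\<close> between
  \<open>A\<^sub>p\<close> and \<open>B\<^sub>p\<close> is again local and inherits being centered and going-down, so it equals the image
  of \<open>A\<^sub>p\<close>. As \<open>A\<^sub>p\<close> contains the kernel, \<open>T = A\<^sub>p\<close>.
\<close>

section \<open>Ideals and surjective homomorphisms\<close>

lemma (in cring) subring_is_cring: "subring H R \<Longrightarrow> cring (R\<lparr>carrier := H\<rparr>)"
  using subcringI' subcring_iff subringE(1) by blast

lemma (in ring) subring_of_subring:
  assumes "subring H R" "subring K R" "H \<subseteq> K"
  shows "subring H (R\<lparr>carrier := K\<rparr>)"
proof -
  interpret K: ring "R\<lparr>carrier := K\<rparr>" using assms(2) by (rule subring_is_ring)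
  show ?thesis
    using subring_is_ring[OF assms(1)] K.ring_incl_imp_subring[of H] assms(3) by simp
qed

text \<open>Used for B -> B/J, for the map it induces on localizations, and for the restrictions of
  both to subrings.\<close>

locale surj_ring_hom = ring_hom_cring +
  assumes surj: "h ` carrier R = carrier S"
begin

lemma hom_eq_kernelE:
  assumes "x \<in> carrier R" "a \<in> carrier R" "h x = h a"
  obtains k where "k \<in> a_kernel R S h" "x = k \<oplus> a"
  using ring.homeq_imp_rcos[OF assms(2,1,3)] by (auto simp: a_r_coset_def')

text \<open>If \<open>h r = h i\<close> with \<open>i\<close> in \<open>I\<close>, then
  \<open>r\<close> and \<open>i\<close> differ by a kernel element, which lies in \<open>I\<close>.
  With \<open>image_vimage_ideal\<close> this gives the correspondence between ideals of
  \<open>S\<close> and ideals of \<open>R\<close> above the kernel.\<close>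

lemma vimage_image_ideal:
  assumes "ideal I R" "a_kernel R S h \<subseteq> I"
  shows "{r \<in> carrier R. h r \<in> h ` I} = I"
proof
  interpret ideal I R by fact
  show "I \<subseteq> {r \<in> carrier R. h r \<in> h ` I}" by auto
  show "{r \<in> carrier R. h r \<in> h ` I} \<subseteq> I"
  proof clarify
    fix r i assume r: "r \<in> carrier R" "i \<in> I" "h r = h i"
    then obtain k where "k \<in> a_kernel R S h" "r = k \<oplus> i"
      using hom_eq_kernelE[OF r(1) a_Hcarr[OF r(2)] r(3)] by blast
    then show "r \<in> I"
      using additive_subgroup.a_closed[OF additive_subgroup_axioms _ r(2)] assms(2) by blast
  qed
qed

lemma kernel_le_vimage:
  assumes "ideal I S"
  shows "a_kernel R S h \<subseteq> {r \<in> carrier R. h r \<in> I}"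
  using additive_subgroup.zero_closed[OF ideal.axioms(1)[OF assms]]
  unfolding a_kernel_def' by auto

lemma image_vimage_ideal:
  assumes "ideal I S"
  shows "h ` {r \<in> carrier R. h r \<in> I} = I"
proof -
  have "I \<subseteq> h ` carrier R"
    using additive_subgroup.a_subset[OF ideal.axioms(1)[OF assms]] surj by simp
  then show ?thesis by auto
qed

lemma ideal_image:
  assumes "ideal I R"
  shows "ideal (h ` I) S"
proof (rule idealI)
  interpret I: ideal I R by fact
  show "ring S" by (rule S.ring_axioms)
  show "subgroup (h ` I) (add_monoid S)"
  proof (rule S.add.subgroupI)
    show "h ` I \<subseteq> carrier S" by auto
    show "h ` I \<noteq> {}" using additive_subgroup.zero_closed[OF I.additive_subgroup_axioms] by blast
    fix x assume "x \<in> h ` I"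
    then obtain i where i: "i \<in> I" "x = h i" by blast
    then show "\<ominus>\<^bsub>S\<^esub> x \<in> h ` I" by (intro image_eqI[of _ _ "\<ominus> i"]) auto
    fix y assume "y \<in> h ` I"
    then obtain j where j: "j \<in> I" "y = h j" by blast
    then show "x \<oplus>\<^bsub>S\<^esub> y \<in> h ` I" using i by (intro image_eqI[of _ _ "i \<oplus> j"]) auto
  qed
  fix a x assume "a \<in> h ` I" "x \<in> carrier S"
  then obtain i r where i: "i \<in> I" "a = h i" "r \<in> carrier R" "x = h r" using surj by blast
  then have "x \<otimes>\<^bsub>S\<^esub> a = h (r \<otimes> i)" "a \<otimes>\<^bsub>S\<^esub> x = h (i \<otimes> r)" by auto
  then show "x \<otimes>\<^bsub>S\<^esub> a \<in> h ` I" "a \<otimes>\<^bsub>S\<^esub> x \<in> h ` I"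
    using I.I_l_closed[OF i(1,3)] I.I_r_closed[OF i(1,3)] by blast+
qed

lemma image_ne_carrier:
  assumes "ideal I R" "a_kernel R S h \<subseteq> I" "carrier R \<noteq> I"
  shows "carrier S \<noteq> h ` I"
proof
  assume "carrier S = h ` I"
  then have "carrier R = {r \<in> carrier R. h r \<in> h ` I}" using surj by auto
  then show False using vimage_image_ideal[OF assms(1,2)] assms(3) by simp
qed

lemma vimage_ne_carrier:
  assumes "ideal I S" "carrier S \<noteq> I"
  shows "carrier R \<noteq> {r \<in> carrier R. h r \<in> I}"
  using image_vimage_ideal[OF assms(1)] assms(2) surj by metis

lemma primeideal_image:
  assumes "primeideal I R" "a_kernel R S h \<subseteq> I"
  shows "primeideal (h ` I) S"
proof (rule primeidealI)
  interpret I: primeideal I R by fact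
  show "ideal (h ` I) S" by (rule ideal_image[OF I.ideal_axioms])
  show "carrier S \<noteq> h ` I" by (rule image_ne_carrier[OF I.ideal_axioms assms(2) I.I_notcarr])
  fix a b assume h: "a \<in> carrier S" "b \<in> carrier S" "a \<otimes>\<^bsub>S\<^esub> b \<in> h ` I"
  then obtain x y where xy: "x \<in> carrier R" "y \<in> carrier R" "a = h x" "b = h y"
    using surj by blast
  then have "x \<otimes> y \<in> {r \<in> carrier R. h r \<in> h ` I}" using h(3) by simp
  then have "x \<otimes> y \<in> I" using vimage_image_ideal[OF I.ideal_axioms assms(2)] by blast
  then show "a \<in> h ` I \<or> b \<in> h ` I" using I.I_prime[of x y] xy by blast
qed (rule S.is_cring)

lemma primeideal_vimage:
  assumes "primeideal I S"
  shows "primeideal {r \<in> carrier R. h r \<in> I} R"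
proof (rule primeidealI)
  interpret I: primeideal I S by fact
  show "ideal {r \<in> carrier R. h r \<in> I} R" by (rule ring.ideal_vimage[OF I.ideal_axioms])
  show "carrier R \<noteq> {r \<in> carrier R. h r \<in> I}"
    by (rule vimage_ne_carrier[OF I.ideal_axioms I.I_notcarr])
qed (use primeideal.I_prime[OF assms] in \<open>auto intro: R.is_cring\<close>)

lemma maximalideal_image:
  assumes "maximalideal M R" "a_kernel R S h \<subseteq> M"
  shows "maximalideal (h ` M) S"
proof (rule maximalidealI)
  interpret M: maximalideal M R by fact
  show "ideal (h ` M) S" by (rule ideal_image[OF M.ideal_axioms])
  show "carrier S \<noteq> h ` M" by (rule image_ne_carrier[OF M.ideal_axioms assms(2) M.I_notcarr])
  fix I assume I: "ideal I S" "h ` M \<subseteq> I" "I \<subseteq> carrier S"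
  have "M \<subseteq> {r \<in> carrier R. h r \<in> I}" using I(2) M.a_subset by auto
  then have "{r \<in> carrier R. h r \<in> I} = M \<or> {r \<in> carrier R. h r \<in> I} = carrier R"
    using M.I_maximal[OF ring.ideal_vimage[OF I(1)]] by auto
  then show "I = h ` M \<or> I = carrier S" using image_vimage_ideal[OF I(1)] surj by metis
qed

text \<open>An ideal above the preimage of \<open>M\<close> contains the kernel, so it is determined
  by its image, which lies above \<open>M\<close>.\<close>

lemma maximalideal_vimage:
  assumes "maximalideal M S"
  shows "maximalideal {r \<in> carrier R. h r \<in> M} R"
proof (rule maximalidealI)
  interpret M: maximalideal M S by fact
  show "ideal {r \<in> carrier R. h r \<in> M} R" by (rule ring.ideal_vimage[OF M.ideal_axioms])
  show "carrier R \<noteq> {r \<in> carrier R. h r \<in> M}"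
    by (rule vimage_ne_carrier[OF M.ideal_axioms M.I_notcarr])
  fix I assume I: "ideal I R" "{r \<in> carrier R. h r \<in> M} \<subseteq> I" "I \<subseteq> carrier R"
  have vi: "{r \<in> carrier R. h r \<in> h ` I} = I"
    using kernel_le_vimage[OF M.ideal_axioms] I(2) by (intro vimage_image_ideal[OF I(1)]) blast
  have "M \<subseteq> h ` I" using image_vimage_ideal[OF M.ideal_axioms] I(2) by blast
  then have "h ` I = M \<or> h ` I = carrier S"
    using M.I_maximal[OF ideal_image[OF I(1)]] I(3) surj by blast
  then show "I = {r \<in> carrier R. h r \<in> M} \<or> I = carrier R"
  proof
    assume "h ` I = carrier S"
    then have "{r \<in> carrier R. h r \<in> h ` I} = carrier R" by auto
    then show ?thesis using vi by simp
  qed (use vi in simp)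
qed

text \<open>The preimage of a maximal ideal of \<open>S\<close> is maximal in \<open>R\<close>,
  hence equals \<open>N\<close>. The equivalence yields locality and also evaluates the description
  \<open>THE N\<close> in \<open>centered_on\<close>.\<close>

lemma maximalideal_iff_image:
  assumes "\<And>M. maximalideal M R \<longleftrightarrow> M = N" "a_kernel R S h \<subseteq> N"
  shows "maximalideal M S \<longleftrightarrow> M = h ` N"
proof
  assume M: "maximalideal M S"
  then have "{r \<in> carrier R. h r \<in> M} = N"
    using assms(1) maximalideal_vimage by simp
  then show "M = h ` N"
    using image_vimage_ideal[OF maximalideal.axioms(1)[OF M]] by simp
next
  have "maximalideal N R" using assms(1) by simp
  then show "M = h ` N \<Longrightarrow> maximalideal M S"
    using maximalideal_image[OF _ assms(2)] by simp
qed

section \<open>Restriction to subrings and transfer of going-down\<close>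

lemma surj_ring_hom_subring:
  assumes "subring H R"
  shows "surj_ring_hom (R\<lparr>carrier := H\<rparr>) (S\<lparr>carrier := h ` H\<rparr>) h"
proof (intro surj_ring_hom.intro surj_ring_hom_axioms.intro ring_hom_cring.intro
    ring_hom_cring_axioms.intro)
  show "cring (R\<lparr>carrier := H\<rparr>)" "cring (S\<lparr>carrier := h ` H\<rparr>)"
    using R.subring_is_cring[OF assms] S.subring_is_cring[OF ring.img_is_subring[OF assms]] .
  show "h \<in> ring_hom (R\<lparr>carrier := H\<rparr>) (S\<lparr>carrier := h ` H\<rparr>)"
    using subringE(1)[OF assms] by (intro ring_hom_memI) (auto simp: subset_eq)
qed simp

lemma mem_subring_if_hom_eq:
  assumes "subring H R" "a_kernel R S h \<subseteq> H" "x \<in> carrier R" "a \<in> H" "h x = h a"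
  shows "x \<in> H"
proof -
  have a: "a \<in> carrier R" using assms(4) subringE(1)[OF assms(1)] by blast
  then obtain k where "k \<in> a_kernel R S h" "x = k \<oplus> a"
    using hom_eq_kernelE[OF assms(3) _ assms(5)] by blast
  then show ?thesis using subringE(7)[OF assms(1) _ assms(4)] assms(2) by blast
qed

text \<open>Images need not commute with intersections; they do here because \<open>H\<close>
  contains the kernel and so is the full preimage of its image. This transports contractions to
  \<open>H\<close>.\<close>

lemma inter_image:
  assumes "I \<subseteq> carrier R" "subring H R" "a_kernel R S h \<subseteq> H"
  shows "h ` I \<inter> h ` H = h ` (I \<inter> H)"
proof
  show "h ` I \<inter> h ` H \<subseteq> h ` (I \<inter> H)"
  proof
    fix y assume "y \<in> h ` I \<inter> h ` H"
    then obtain i a where i: "i \<in> I" "y = h i" "a \<in> H" "h i = h a" by auto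
    then have "i \<in> H" using mem_subring_if_hom_eq[OF assms(2,3)] assms(1) by blast
    then show "y \<in> h ` (I \<inter> H)" using i(1,2) by blast
  qed
qed blast

lemma subset_if_image_subset:
  assumes "I \<subseteq> carrier R" "subring H R" "a_kernel R S h \<subseteq> H" "h ` I \<subseteq> h ` H"
  shows "I \<subseteq> H"
proof
  fix i assume i: "i \<in> I"
  then obtain a where "a \<in> H" "h i = h a" using assms(4) by blast
  then show "i \<in> H" using mem_subring_if_hom_eq[OF assms(2,3)] i assms(1) by blast
qed

text \<open>Pull the primes back along \<open>h\<close>, apply going-down upstairs, and push the
  prime found there forward again.\<close>

lemma going_down_image:
  assumes H: "subring H R" and K: "a_kernel R S h \<subseteq> H" and gd: "going_down (R\<lparr>carrier := H\<rparr>) R"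
  shows "going_down (S\<lparr>carrier := h ` H\<rparr>) S"
  unfolding going_down_def
proof clarify
  interpret H: surj_ring_hom "R\<lparr>carrier := H\<rparr>" "S\<lparr>carrier := h ` H\<rparr>" h
    using H by (rule surj_ring_hom_subring)
  have HR: "H \<subseteq> carrier R" using H by (rule subringE(1))
  fix p1 Q2
  assume p1: "primeideal p1 (S\<lparr>carrier := h ` H\<rparr>)"
    and p2: "primeideal (Q2 \<inter> carrier (S\<lparr>carrier := h ` H\<rparr>)) (S\<lparr>carrier := h ` H\<rparr>)"
    and le: "p1 \<subseteq> Q2 \<inter> carrier (S\<lparr>carrier := h ` H\<rparr>)" and Q2: "primeideal Q2 S"
  define P1 where "P1 = {r \<in> H. h r \<in> p1}"
  define R2 where "R2 = {r \<in> carrier R. h r \<in> Q2}"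
  have P1: "primeideal P1 (R\<lparr>carrier := H\<rparr>)"
    using H.primeideal_vimage[OF p1] by (simp add: P1_def)
  have R2: "primeideal R2 R" using primeideal_vimage[OF Q2] by (simp add: R2_def)
  \<comment> \<open>The contraction of \<open>R2\<close> to \<open>H\<close> is the preimage of the
    contraction of \<open>Q2\<close>, hence prime.\<close>
  have "R2 \<inter> carrier (R\<lparr>carrier := H\<rparr>) =
      {r \<in> carrier (R\<lparr>carrier := H\<rparr>). h r \<in> Q2 \<inter> carrier (S\<lparr>carrier := h ` H\<rparr>)}"
    using HR by (auto simp: R2_def)
  then have P2: "primeideal (R2 \<inter> H) (R\<lparr>carrier := H\<rparr>)"
    using H.primeideal_vimage[OF p2] by simp
  have "P1 \<subseteq> R2 \<inter> H" using le HR by (auto simp: P1_def R2_def)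
  then have "\<exists>Q1. primeideal Q1 R \<and> Q1 \<subseteq> R2 \<and> Q1 \<inter> carrier (R\<lparr>carrier := H\<rparr>) = P1"
    using P1 P2 R2 by (intro gd[unfolded going_down_def, rule_format, of P1 "R2 \<inter> H"]) simp
  then obtain R1 where R1: "primeideal R1 R" "R1 \<subseteq> R2" "R1 \<inter> H = P1" by auto
  \<comment> \<open>The kernel lies in \<open>H\<close> and maps to zero, which is in
    \<open>p1\<close>. As \<open>P1\<close> is contained in \<open>R1\<close>, the image of
    \<open>R1\<close> is therefore prime.\<close>
  have KP1: "a_kernel R S h \<subseteq> P1"
  proof
    fix x assume x: "x \<in> a_kernel R S h"
    have "\<zero>\<^bsub>S\<^esub> \<in> p1"
      using additive_subgroup.zero_closed[OF ideal.axioms(1)[OF primeideal.axioms(1)[OF p1]]] by simp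
    then show "x \<in> P1" unfolding P1_def using K x by auto
  qed
  have R1c: "R1 \<subseteq> carrier R"
    using R1(1) by (meson additive_subgroup.a_subset ideal.axioms(1) primeideal.axioms(1))
  show "\<exists>Q1. primeideal Q1 S \<and> Q1 \<subseteq> Q2 \<and> Q1 \<inter> carrier (S\<lparr>carrier := h ` H\<rparr>) = p1"
  proof (intro exI conjI)
    show "primeideal (h ` R1) S" using primeideal_image[OF R1(1)] KP1 R1(3) by blast
    show "h ` R1 \<subseteq> Q2" using R1(2) by (auto simp: R2_def)
    have "h ` P1 = p1"
      using H.image_vimage_ideal[OF primeideal.axioms(1)[OF p1]] by (simp add: P1_def)
    then show "h ` R1 \<inter> carrier (S\<lparr>carrier := h ` H\<rparr>) = p1"
      using inter_image[OF R1c H K] R1(3) by simp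
  qed
qed

end

section \<open>The quotient map and its kernel\<close>

lemma (in ideal) surj_ring_hom_quotient:
  assumes "cring R"
  shows "surj_ring_hom R (R Quot I) ((+>) I)"
proof (intro surj_ring_hom.intro surj_ring_hom_axioms.intro)
  show "ring_hom_cring R (R Quot I) ((+>) I)" using assms by (rule rcos_ring_hom_cring)
  show "(+>) I ` carrier R = carrier (R Quot I)" by (auto simp: FactRing_def A_RCOSETS_def')
qed

lemma (in ideal) kernel_rcos: "a_kernel R (R Quot I) ((+>) I) = I"
proof -
  have "a_kernel R (R Quot I) ((+>) I) = {x \<in> carrier R. I +> x = I}"
    unfolding a_kernel_def' by (simp add: FactRing_def)
  also have "\<dots> = I"
    using rcos_const_imp_mem a_rcos_zero[OF is_ideal] Icarr by blast
  finally show ?thesis .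
qed

section \<open>Functoriality of localization\<close>

text \<open>The union over representatives follows the encoding of the operations of
  \<open>localization\<close>; \<open>localization_map_fraction\<close> shows independence of the
  representative.\<close>

definition localization_map :: "('b, 'n) ring_scheme \<Rightarrow> 'b set \<Rightarrow> ('a \<Rightarrow> 'b) \<Rightarrow> ('a \<times> 'a) set \<Rightarrow> ('b \<times> 'b) set"
  where "localization_map S V h X = (\<Union>(a, s)\<in>X. fraction S V (h a) (h s))"

text \<open>Equality in \<open>image_U\<close> lets every denominator in \<open>V\<close> be lifted
  to \<open>U\<close>, which gives surjectivity and control of the kernel.\<close>

locale localizing_hom = surj_ring_hom + U: localizing R U + V: localizing S V
  for U V +
  assumes image_U: "h ` U = V"
begin

lemma hom_U: "s \<in> U \<Longrightarrow> h s \<in> V"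
  using image_U by blast

text \<open>Applying \<open>h\<close> to an equation that identifies two fractions over
  \<open>U\<close>, with factor \<open>u\<close>, gives such an equation over \<open>V\<close> with
  factor \<open>h u\<close>.\<close>

lemma localization_map_fraction:
  assumes "a \<in> carrier R" "s \<in> U"
  shows "localization_map S V h (fraction R U a s) = fraction S V (h a) (h s)"
proof -
  have "fraction S V (h b) (h t) = fraction S V (h a) (h s)" if bt: "(b, t) \<in> fraction R U a s" for b t
  proof -
    obtain u where u: "b \<in> carrier R" "t \<in> U" "u \<in> U" "u \<otimes> (t \<otimes> a) = u \<otimes> (s \<otimes> b)"
      using bt assms by (auto simp: U.fraction_mem_iff)
    note c = U.S_carr[OF u(2)] U.S_carr[OF u(3)] U.S_carr[OF assms(2)]
    have "h u \<otimes>\<^bsub>S\<^esub> (h s \<otimes>\<^bsub>S\<^esub> h b) = h u \<otimes>\<^bsub>S\<^esub> (h t \<otimes>\<^bsub>S\<^esub> h a)"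
      using arg_cong[OF u(4), of h] c u(1) assms(1) by simp
    then show ?thesis
      using u assms hom_U by (subst V.fraction_eq_iff) (auto intro!: bexI[of _ "h u"])
  qed
  then show ?thesis
    unfolding localization_map_def using U.fraction_self[OF assms] by fast
qed

lemma image_fractions:
  assumes "X \<subseteq> carrier R"
  shows "localization_map S V h ` fractions R U X = fractions S V (h ` X)"
proof
  show "localization_map S V h ` fractions R U X \<subseteq> fractions S V (h ` X)"
  proof
    fix Y assume "Y \<in> localization_map S V h ` fractions R U X"
    then obtain x s where x: "x \<in> X" "s \<in> U" "Y = localization_map S V h (fraction R U x s)"
      unfolding fractions_def by blast
    then have "Y = fraction S V (h x) (h s)"
      using assms by (simp add: localization_map_fraction subset_eq)
    then show "Y \<in> fractions S V (h ` X)" using x(1) hom_U[OF x(2)] unfolding fractions_def by blast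
  qed
  show "fractions S V (h ` X) \<subseteq> localization_map S V h ` fractions R U X"
  proof
    fix Y assume "Y \<in> fractions S V (h ` X)"
    then obtain x s where x: "x \<in> X" "s \<in> U" "Y = fraction S V (h x) (h s)"
      unfolding fractions_def image_U[symmetric] by blast
    then have "Y = localization_map S V h (fraction R U x s)"
      using assms by (simp add: localization_map_fraction subset_eq)
    moreover have "fraction R U x s \<in> fractions R U X" using x by (auto simp: fractions_def)
    ultimately show "Y \<in> localization_map S V h ` fractions R U X" by blast
  qed
qed

lemma surj_ring_hom_localization:
  "surj_ring_hom (localization R U) (localization S V) (localization_map S V h)"
proof (intro surj_ring_hom.intro surj_ring_hom_axioms.intro ring_hom_cring.intro
    ring_hom_cring_axioms.intro ring_hom_memI)
  show "cring (localization R U)" "cring (localization S V)"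
    by (rule U.localization_cring V.localization_cring)+
  show im: "localization_map S V h ` carrier (localization R U) = carrier (localization S V)"
    using image_fractions[of "carrier R"] surj by (simp add: localization_def)
  fix X assume X: "X \<in> carrier (localization R U)"
  then show "localization_map S V h X \<in> carrier (localization S V)" using im by blast
  from X obtain a s where X: "a \<in> carrier R" "s \<in> U" "X = fraction R U a s"
    by (rule U.localization_carrierE)
  fix Y assume "Y \<in> carrier (localization R U)"
  then obtain b t where Y: "b \<in> carrier R" "t \<in> U" "Y = fraction R U b t"
    by (rule U.localization_carrierE)
  note c = X(1,2) Y(1,2) U.S_carr[OF X(2)] U.S_carr[OF Y(2)] hom_U[OF X(2)] hom_U[OF Y(2)]
  show "localization_map S V h (X \<otimes>\<^bsub>localization R U\<^esub> Y) =
      localization_map S V h X \<otimes>\<^bsub>localization S V\<^esub> localization_map S V h Y"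
    using c by (simp add: X(3) Y(3) localization_map_fraction U.mult_fraction V.mult_fraction)
  show "localization_map S V h (X \<oplus>\<^bsub>localization R U\<^esub> Y) =
      localization_map S V h X \<oplus>\<^bsub>localization S V\<^esub> localization_map S V h Y"
    using c by (simp add: X(3) Y(3) localization_map_fraction U.add_fraction V.add_fraction)
next
  show "localization_map S V h \<one>\<^bsub>localization R U\<^esub> = \<one>\<^bsub>localization S V\<^esub>"
    by (simp add: U.localization_one V.localization_one localization_map_fraction)
qed

text \<open>If a/s maps to zero, some element of \<open>V\<close> kills \<open>h a\<close>. Lifting
  it to \<open>u\<close> in \<open>U\<close> puts \<open>u \<otimes> a\<close> in the kernel of
  \<open>h\<close>, and a/s = ua/us.\<close>

lemma kernel_localization_map:
  "a_kernel (localization R U) (localization S V) (localization_map S V h) \<subseteq>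
     fractions R U (a_kernel R S h)"
proof
  fix X assume X: "X \<in> a_kernel (localization R U) (localization S V) (localization_map S V h)"
  then have "X \<in> carrier (localization R U)" unfolding a_kernel_def' by simp
  then obtain a s where as: "a \<in> carrier R" "s \<in> U" "X = fraction R U a s"
    by (rule U.localization_carrierE)
  then have "fraction S V (h a) (h s) = fraction S V \<zero>\<^bsub>S\<^esub> \<one>\<^bsub>S\<^esub>"
    using X unfolding a_kernel_def' by (simp add: localization_map_fraction V.localization_zero)
  then have "\<exists>v\<in>V. v \<otimes>\<^bsub>S\<^esub> h a = \<zero>\<^bsub>S\<^esub>"
    using as hom_U[OF as(2)] V.S_carr by (subst (asm) V.fraction_eq_iff) auto
  then obtain u where u: "u \<in> U" "h u \<otimes>\<^bsub>S\<^esub> h a = \<zero>\<^bsub>S\<^esub>" using image_U by blast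
  note c = U.S_carr[OF u(1)] U.S_carr[OF as(2)]
  have "X = fraction R U (u \<otimes> a) (u \<otimes> s)"
    unfolding as(3) using as(1,2) u(1) c by (intro U.fraction_eqI) (simp_all add: R.m_ac)
  moreover have "u \<otimes> a \<in> a_kernel R S h" using u as c unfolding a_kernel_def' by simp
  ultimately show "X \<in> fractions R U (a_kernel R S h)"
    using u as by (auto simp: fractions_def)
qed

end

section \<open>The local ring at a prime of a subring\<close>

context prime_of_subring
begin

abbreviation "Bp \<equiv> localization B (A - p)"
abbreviation "Ap \<equiv> fractions B (A - p) A"
abbreviation "pAp \<equiv> fractions B (A - p) p"

lemma Ap_cring: "cring (Bp\<lparr>carrier := Ap\<rparr>)"
  by (rule cring.subring_is_cring[OF localization_cring fractions_subring])

lemma pAp_subset: "pAp \<subseteq> Ap"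
  using p_sub by (auto simp: fractions_def)

text \<open>If a/s = x/t with \<open>x\<close> in \<open>p\<close> and \<open>a\<close> outside
  \<open>p\<close>, then uta = usx for some \<open>u\<close> outside \<open>p\<close>. The left side
  is a product of elements outside \<open>p\<close>, the right side lies in
  \<open>p\<close>.\<close>

lemma fraction_mem_pApD:
  assumes "a \<in> A" "s \<in> A - p" "fraction B (A - p) a s \<in> pAp"
  shows "a \<in> p"
proof (rule ccontr)
  assume "a \<notin> p"
  then have a: "a \<in> A - p" using assms(1) by blast
  obtain x t where x: "x \<in> p" "t \<in> A - p" "fraction B (A - p) a s = fraction B (A - p) x t"
    using assms(3) by (auto simp: fractions_def)
  then obtain u where u: "u \<in> A - p" "u \<otimes> (t \<otimes> a) = u \<otimes> (s \<otimes> x)"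
    using assms A_sub p_sub by (subst (asm) fraction_eq_iff) auto
  have "u \<otimes> (t \<otimes> a) \<in> A - p" using u x a by (intro m_closed)
  moreover have "u \<otimes> (s \<otimes> x) \<in> p"
    using p.I_l_closed[of "s \<otimes> x" u] p.I_l_closed[of x s] u(1) x(1) assms(2) by auto
  ultimately show False using u(2) by simp
qed

text \<open>A fraction outside \<open>pAp\<close> has its numerator outside \<open>p\<close> and is
  a unit of \<open>Ap\<close>. Hence every proper ideal lies in \<open>pAp\<close>.\<close>

lemma maximalideal_Ap_iff: "maximalideal M (Bp\<lparr>carrier := Ap\<rparr>) \<longleftrightarrow> M = pAp"
proof -
  interpret Ap: cring "Bp\<lparr>carrier := Ap\<rparr>" by (rule Ap_cring)
  have whole: "I = Ap" if I: "ideal I (Bp\<lparr>carrier := Ap\<rparr>)" "\<not> I \<subseteq> pAp" for I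
  proof -
    interpret I: ideal I "Bp\<lparr>carrier := Ap\<rparr>" by fact
    obtain X where X: "X \<in> I" "X \<notin> pAp" using I(2) by blast
    have "I \<subseteq> Ap" using I.a_subset by simp
    then obtain a s where a: "a \<in> A" "s \<in> A - p" "X = fraction B (A - p) a s"
      using X(1) unfolding fractions_def by blast
    have ap: "a \<in> A - p" using X(2) a(1) fractionsI[OF _ a(2), of a p] unfolding a(3) by blast
    note c = S_carr[OF ap] S_carr[OF a(2)]
    \<comment> \<open>The inverse of a/s is s/a, a legitimate fraction because \<open>a\<close> is
      in \<open>A - p\<close>.\<close>
    have "fraction B (A - p) s a \<in> Ap" using a(2) ap by (intro fractionsI) auto
    then have "fraction B (A - p) s a \<otimes>\<^bsub>Bp\<^esub> X \<in> I" using I.I_l_closed[OF X(1)] by simp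
    moreover have "fraction B (A - p) s a \<otimes>\<^bsub>Bp\<^esub> X = \<one>\<^bsub>Bp\<^esub>"
      unfolding a(3) localization_one mult_fraction[OF c(2) ap c(1) a(2)]
      using c m_closed[OF a(2) ap] one_closed by (intro fraction_eqI) (simp_all add: m_comm)
    ultimately show "I = Ap" using I.one_imp_carrier by simp
  qed
  have "\<one> \<in> A - p" by (rule one_closed)
  then have "\<one>\<^bsub>Bp\<^esub> \<in> Ap" "\<one>\<^bsub>Bp\<^esub> \<notin> pAp"
    unfolding localization_one using fraction_mem_pApD[of \<one> \<one>] by (auto intro: fractionsI)
  then have ne: "pAp \<noteq> Ap" by blast
  have max: "maximalideal pAp (Bp\<lparr>carrier := Ap\<rparr>)"
    using ne whole by (intro maximalidealI fractions_ideal) auto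
  show ?thesis
  proof
    assume "maximalideal M (Bp\<lparr>carrier := Ap\<rparr>)"
    then interpret M: maximalideal M "Bp\<lparr>carrier := Ap\<rparr>" .
    have "M \<subseteq> pAp" using whole[OF M.ideal_axioms] M.I_notcarr by auto
    then show "M = pAp" using M.I_maximal[OF fractions_ideal] ne pAp_subset by auto
  qed (use max in simp)
qed

text \<open>Perinormality demands that the set of candidates equal \<open>{Ap}\<close>, so
  \<open>Ap\<close> itself must qualify. For going-down the smaller prime is its own
  witness.\<close>

lemma Ap_mem_candidates:
  "local_ring (Bp\<lparr>carrier := Ap\<rparr>)"
  "centered_on (Bp\<lparr>carrier := Ap\<rparr>) (Bp\<lparr>carrier := Ap\<rparr>) pAp"
  "going_down (Bp\<lparr>carrier := Ap\<rparr>) (Bp\<lparr>carrier := Ap\<rparr>)"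
proof -
  show "local_ring (Bp\<lparr>carrier := Ap\<rparr>)"
    using Ap_cring by (simp add: local_ring_def maximalideal_Ap_iff)
  show "centered_on (Bp\<lparr>carrier := Ap\<rparr>) (Bp\<lparr>carrier := Ap\<rparr>) pAp"
    using pAp_subset by (simp add: centered_on_def maximalideal_Ap_iff Int_absorb2)
  show "going_down (Bp\<lparr>carrier := Ap\<rparr>) (Bp\<lparr>carrier := Ap\<rparr>)"
    unfolding going_down_def
  proof clarify
    fix p1 Q2 assume h: "primeideal p1 (Bp\<lparr>carrier := Ap\<rparr>)"
      "p1 \<subseteq> Q2 \<inter> carrier (Bp\<lparr>carrier := Ap\<rparr>)"
    then show "\<exists>Q1. primeideal Q1 (Bp\<lparr>carrier := Ap\<rparr>) \<and> Q1 \<subseteq> Q2 \<and>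
        Q1 \<inter> carrier (Bp\<lparr>carrier := Ap\<rparr>) = p1"
      by (intro exI[of _ p1]) auto
  qed
qed

lemma fractions_eq_carrier:
  assumes "ideal J B" "J \<subseteq> A" "\<not> J \<subseteq> p"
  shows "Ap = carrier Bp"
proof
  show "Ap \<subseteq> carrier Bp" using fractions_subring by (rule subringE(1))
  obtain j where j: "j \<in> J" "j \<in> A - p" using assms by blast
  show "carrier Bp \<subseteq> Ap"
  proof
    fix X assume "X \<in> carrier Bp"
    then obtain b s where X: "b \<in> carrier B" "s \<in> A - p" "X = fraction B (A - p) b s"
      by (rule localization_carrierE)
    note c = S_carr[OF j(2)] S_carr[OF X(2)]
    have "X = fraction B (A - p) (j \<otimes> b) (j \<otimes> s)"
      unfolding X(3) using X(1,2) c m_closed[OF j(2) X(2)]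
      by (intro fraction_eqI) (simp_all add: m_ac)
    moreover have "j \<otimes> b \<in> A" using ideal.I_r_closed[OF assms(1) j(1) X(1)] assms(2) by blast
    ultimately show "X \<in> Ap" using m_closed[OF j(2) X(2)] by (auto intro: fractionsI)
  qed
qed

text \<open>All properties of \<open>T\<close> are carried along \<open>?g\<close> to the
  localization of B/J, where perinormality identifies the image of \<open>T\<close>.\<close>

lemma subring_eq_Ap_if_quotient:
  assumes J: "ideal J B" "J \<subseteq> p"
    and per: "perinormal_in ((+>) J ` A) (B Quot J)"
    and T: "subring T Bp" "Ap \<subseteq> T" "local_ring (Bp\<lparr>carrier := T\<rparr>)"
      "centered_on (Bp\<lparr>carrier := T\<rparr>) (Bp\<lparr>carrier := Ap\<rparr>) pAp"
      "going_down (Bp\<lparr>carrier := Ap\<rparr>) (Bp\<lparr>carrier := T\<rparr>)"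
  shows "T = Ap"
proof -
  let ?f = "(+>) J"
  let ?Q = "B Quot J"
  interpret J: ideal J B by fact
  interpret f: surj_ring_hom B ?Q ?f
    using is_cring by (rule J.surj_ring_hom_quotient)
  note ker = J.kernel_rcos
  have A: "subring A B" by (rule A.subring_axioms)
  interpret fA: surj_ring_hom "B\<lparr>carrier := A\<rparr>" "?Q\<lparr>carrier := ?f ` A\<rparr>" ?f
    using A by (rule f.surj_ring_hom_subring)
  have kerA: "a_kernel (B\<lparr>carrier := A\<rparr>) (?Q\<lparr>carrier := ?f ` A\<rparr>) ?f \<subseteq> p"
    using ker J(2) A_sub unfolding a_kernel_def' by auto
  interpret P: prime_of_subring ?Q "?f ` A" "?f ` p"
    using fA.primeideal_image[OF p.primeideal_axioms kerA] f.ring.img_is_subring[OF A]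
    by (intro prime_of_subring.intro f.S.is_cring)
  \<comment> \<open>Because \<open>p\<close> contains the kernel, no element of \<open>A - p\<close>
    has the same image as an element of \<open>p\<close>.\<close>
  have "?f ` (A - p) = ?f ` A - ?f ` p"
    using fA.vimage_image_ideal[OF p.ideal_axioms kerA] by auto
  then interpret loc: localizing_hom B ?Q ?f "A - p" "?f ` A - ?f ` p"
    by unfold_locales
  let ?g = "localization_map ?Q (?f ` A - ?f ` p) ?f"
  interpret g: surj_ring_hom Bp P.Bp ?g by (rule loc.surj_ring_hom_localization)
  interpret gT: surj_ring_hom "Bp\<lparr>carrier := T\<rparr>" "P.Bp\<lparr>carrier := ?g ` T\<rparr>" ?g
    using T(1) by (rule g.surj_ring_hom_subring)
  have gA: "?g ` Ap = P.Ap" and gp: "?g ` pAp = P.pAp"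
    using loc.image_fractions A_sub p_sub by auto
  have Ap: "subring Ap (Bp\<lparr>carrier := T\<rparr>)"
    using g.R.subring_of_subring fractions_subring T(1,2) by blast
  \<comment> \<open>The kernel consists of fractions with numerator in \<open>J\<close>, and
    \<open>J\<close> lies in \<open>p\<close>.\<close>
  have kerg: "a_kernel Bp P.Bp ?g \<subseteq> pAp"
    using loc.kernel_localization_map J(2) unfolding ker fractions_def by blast
  then have kergT: "a_kernel (Bp\<lparr>carrier := T\<rparr>) (P.Bp\<lparr>carrier := ?g ` T\<rparr>) ?g \<subseteq> pAp"
    using subringE(1)[OF T(1)] unfolding a_kernel_def' by auto
  obtain N where N: "\<And>M. maximalideal M (Bp\<lparr>carrier := T\<rparr>) \<longleftrightarrow> M = N"
    using T(3) unfolding local_ring_def by metis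
  then have NA: "N \<inter> Ap = pAp" using T(4) by (simp add: centered_on_def)
  have NT: "N \<subseteq> T"
    using N[of N] additive_subgroup.a_subset[OF ideal.axioms(1)[OF maximalideal.axioms(1)]] by fastforce
  \<comment> \<open>The kernel lies in \<open>pAp\<close>, which equals the contraction of
    \<open>N\<close> and so is contained in \<open>N\<close>; hence \<open>N\<close> corresponds to
    the unique maximal ideal of the image.\<close>
  have maxT: "maximalideal M (P.Bp\<lparr>carrier := ?g ` T\<rparr>) \<longleftrightarrow> M = ?g ` N" for M
    using N kergT NA by (intro gT.maximalideal_iff_image) auto
  have "?g ` T = P.Ap"
  proof -
    have "subring (?g ` T) P.Bp" using T(1) by (rule g.ring.img_is_subring)
    moreover have "P.Ap \<subseteq> ?g ` T" using T(2) gA by blast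
    moreover have "local_ring (P.Bp\<lparr>carrier := ?g ` T\<rparr>)"
      using gT.S.is_cring by (simp add: local_ring_def maxT)
    \<comment> \<open>\<open>Ap\<close> contains the kernel, so the contraction of the image of
      \<open>N\<close> is the image of the contraction \<open>pAp\<close>.\<close>
    moreover have "centered_on (P.Bp\<lparr>carrier := ?g ` T\<rparr>) (P.Bp\<lparr>carrier := P.Ap\<rparr>) P.pAp"
      using gT.inter_image[OF _ Ap, of N] NT NA kergT pAp_subset
      by (simp add: centered_on_def maxT gA gp)
    moreover have "going_down (P.Bp\<lparr>carrier := P.Ap\<rparr>) (P.Bp\<lparr>carrier := ?g ` T\<rparr>)"
      using gT.going_down_image[OF Ap] T(5) kergT pAp_subset by (simp add: gA)
    \<comment> \<open>Perinormality, read from right to left, turns the singleton into the set of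
      candidates, whose conditions were just collected.\<close>
    ultimately have "?g ` T \<in> {P.Ap}"
      unfolding per[unfolded perinormal_in_def Let_def, rule_format,
          OF P.p.primeideal_axioms, symmetric] mem_Collect_eq
      by (intro conjI)
    then show ?thesis by simp
  qed
  \<comment> \<open>\<open>T\<close> and \<open>Ap\<close> have the same image and \<open>Ap\<close>
    contains the kernel.\<close>
  then have "T \<subseteq> Ap"
    using g.subset_if_image_subset[OF subringE(1)[OF T(1)] fractions_subring] kerg pAp_subset gA by auto
  then show ?thesis using T(2) by blast
qed

end

theorem proposition2p3:
  fixes B :: "('a, 'm) ring_scheme" and A J :: "'a set"
  assumes "cring B"
    and "subring A B"
    and "ideal J B"
    and "J \<subseteq> A"
    and "perinormal_in (carrier (B\<lparr>carrier := A\<rparr> Quot J)) (B Quot J)"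
  shows "perinormal_in A B"
  unfolding perinormal_in_def Let_def
proof (intro allI impI)
  fix p assume p: "primeideal p (B\<lparr>carrier := A\<rparr>)"
  interpret prime_of_subring B A p
    using assms(1,2) p by (rule prime_of_subring.intro)
  have per: "perinormal_in ((+>\<^bsub>B\<^esub>) J ` A) (B Quot J)"
  proof -
    \<comment> \<open>Cosets of \<open>J\<close> by elements of \<open>A\<close> are the same sets
      in \<open>A\<close> and in \<open>B\<close>, so A/J is literally the image of \<open>A\<close>
      in B/J.\<close>
    have "carrier (B\<lparr>carrier := A\<rparr> Quot J) = (+>\<^bsub>B\<^esub>) J ` A"
      by (auto simp: FactRing_def A_RCOSETS_def' a_r_coset_def')
    then show ?thesis using assms(5) by simp
  qed
  have "T = Ap" if "subring T Bp" "Ap \<subseteq> T" "local_ring (Bp\<lparr>carrier := T\<rparr>)"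
      "centered_on (Bp\<lparr>carrier := T\<rparr>) (Bp\<lparr>carrier := Ap\<rparr>) pAp"
      "going_down (Bp\<lparr>carrier := Ap\<rparr>) (Bp\<lparr>carrier := T\<rparr>)" for T
  proof (cases "J \<subseteq> p")
    case True
    then show ?thesis using subring_eq_Ap_if_quotient[OF assms(3) _ per that] by blast
  next
    \<comment> \<open>Here \<open>Ap\<close> is all of \<open>Bp\<close>, so \<open>T\<close> is
      squeezed between equal rings.\<close>
    case False
    then show ?thesis
      using fractions_eq_carrier[OF assms(3,4)] subringE(1)[OF that(1)] that(2) by blast
  qed
  then show "{T. subring T Bp \<and> Ap \<subseteq> T \<and> local_ring (Bp\<lparr>carrier := T\<rparr>) \<and>
      centered_on (Bp\<lparr>carrier := T\<rparr>) (Bp\<lparr>carrier := Ap\<rparr>) pAp \<and>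
      going_down (Bp\<lparr>carrier := Ap\<rparr>) (Bp\<lparr>carrier := T\<rparr>)} = {Ap}"
    using Ap_mem_candidates fractions_subring by auto
qed

end
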